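(* Let $\mathbf{R}_u,\mathbf{R}_v,\mathbf{R}_0\in\mathbb{R}^3$ and $\mathbf{R}(u,v)=\mathbf{R}_u u+\mathbf{R}_v v+\mathbf{R}_0$. Define $$g_n^m(u,v)=R_n^m(\mathbf{R}(u,v)),\qquad i_n^m=\int_0^1\int_0^{1-u}g_n^m(u,v)\,dv\,du,$$ $$j_n^m=\int_0^1 h_n^m(u)\,du,\qquad h_n^m(u)=g_n^m(u,1-u).$$ Then for all integers $n\ge 1$ and $-n\le m\le n$, $$i_n^m=\frac{1}{n+2}\left(i\xi_0\,i_{n-1}^{m-1}+i\eta_0\,i_{n-1}^{m+1}-z_0\,i_{n-1}^m+j_n^m\right),$$ where, writing $\mathbf{R}_0=(x_0,y_0,z_0)$, $\xi_0=\frac{x_0+iy_0}{2}$ and $\eta_0=\frac{x_0-iy_0}{2}$. (The symbol $i$ without indices is the imaginary unit; $i_n^m$ with indices is the integral $\int_0^1\int_0^{1-u}g_n^m(u,v)\,dv\,du$.)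
   Context: Harmonic polynomials: for $\mathbf{r}=(x,y,z)=r(\sin\theta\cos\varphi,\sin\theta\sin\varphi,\cos\theta)\in\mathbb{R}^3$, integers $n\ge 0$ and $-n\le m\le n$, $$R_n^m(\mathbf{r})=\frac{(-1)^n i^{|m|}}{(n+|m|)!}\,r^n P_n^{|m|}(\cos\theta)\,e^{im\varphi},$$ and $R_n^m\equiv 0$ for $|m|>n$; here $i^{|m|}$ is a power of the imaginary unit. Each $R_n^m$ is a homogeneous polynomial of degree $n$ in $(x,y,z)$ (this defines it also at points where $\theta,\varphi$ are not uniquely defined; $R_0^0\equiv 1$). The associated Legendre functions are, for integers $n,m\ge 0$, $$P_n^m(\mu)=\frac{(-1)^m(1-\mu^2)^{m/2}}{2^n n!}\frac{d^{m+n}}{d\mu^{m+n}}(\mu^2-1)^n.$$ Accordingly all indexed quantities built from $R_n^m$ vanish when $|m|>n$. *)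

theory Defs
  imports "HOL-Analysis.Analysis"
begin

text \<open>
  For \<open>\<mu>\<close> in \<open>[-1, 1]\<close> the factor \<open>(1 - \<mu>\<^sup>2)\<^bsup>m/2\<^esup>\<close> is written as a natural power of the
  square root, because \<open>0 powr 0 = 0\<close> would give the wrong value for \<open>m = 0\<close> at
  \<open>\<mu> = 1\<close> and \<open>\<mu> = -1\<close>.
\<close>

definition assoc_legendre :: "nat \<Rightarrow> nat \<Rightarrow> real \<Rightarrow> real" where
  "assoc_legendre n m \<mu> =
     (-1) ^ m * sqrt (1 - \<mu>\<^sup>2) ^ m / (2 ^ n * fact n) *
     (deriv ^^ (m + n)) (\<lambda>x. (x\<^sup>2 - 1) ^ n) \<mu>"

definition harmonic_R_spherical :: "nat \<Rightarrow> int \<Rightarrow> real \<Rightarrow> real \<Rightarrow> real \<Rightarrow> complex" where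
  "harmonic_R_spherical n m r \<theta> \<phi> =
     (if \<bar>m\<bar> > int n then 0
      else (-1) ^ n * \<i> ^ nat \<bar>m\<bar> / fact (n + nat \<bar>m\<bar>) *
           of_real (r ^ n * assoc_legendre n (nat \<bar>m\<bar>) (cos \<theta>)) *
           exp (\<i> * of_int m * of_real \<phi>))"

text \<open>
  The Cartesian form picks one choice of spherical coordinates. The lemma
  \<open>harmonic_R_spherical_coords\<close> below shows that every choice gives the same value, including
  on the \<open>z\<close>-axis and at the origin, where \<open>0 ^ 0 = 1\<close> yields \<open>harmonic_R 0 0 0 = 1\<close>.
\<close>

definition harmonic_R :: "nat \<Rightarrow> int \<Rightarrow> real ^ 3 \<Rightarrow> complex" where
  "harmonic_R n m p =
     harmonic_R_spherical n m (norm p) (arccos (p $ 3 / norm p)) (Arg (Complex (p $ 1) (p $ 2)))"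

lemma assoc_legendre_0_0: "assoc_legendre 0 0 \<mu> = 1"
  by (simp add: assoc_legendre_def)

lemma assoc_legendre_pole:
  assumes "m > 0" "\<mu>\<^sup>2 = 1"
  shows "assoc_legendre n m \<mu> = 0"
  using assms by (simp add: assoc_legendre_def)

lemma harmonic_R_spherical_coords:
  assumes "r \<ge> 0" "0 \<le> \<theta>" "\<theta> \<le> pi"
  shows "harmonic_R n m (vector [r * (sin \<theta> * cos \<phi>), r * (sin \<theta> * sin \<phi>), r * cos \<theta>]) =
         harmonic_R_spherical n m r \<theta> \<phi>"
proof -
  define p :: "real ^ 3"
    where "p = vector [r * (sin \<theta> * cos \<phi>), r * (sin \<theta> * sin \<phi>), r * cos \<theta>]"
  have p: "p $ 1 = r * (sin \<theta> * cos \<phi>)" "p $ 2 = r * (sin \<theta> * sin \<phi>)" "p $ 3 = r * cos \<theta>"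
    by (simp_all add: p_def)
  have "(norm p)\<^sup>2 = (r * (sin \<theta> * cos \<phi>))\<^sup>2 + (r * (sin \<theta> * sin \<phi>))\<^sup>2 + (r * cos \<theta>)\<^sup>2"
    unfolding power2_norm_eq_inner by (simp add: inner_vec_def sum_3 p power2_eq_square)
  also have "\<dots> = r\<^sup>2 * ((sin \<theta>)\<^sup>2 * ((cos \<phi>)\<^sup>2 + (sin \<phi>)\<^sup>2) + (cos \<theta>)\<^sup>2)"
    by algebra
  also have "\<dots> = r\<^sup>2" by (simp only: sin_cos_squared_add sin_cos_squared_add2 mult_1_right)
  finally have norm_p: "norm p = r"
    using assms(1) by (simp add: power2_eq_iff_nonneg)
  have "harmonic_R n m p = harmonic_R_spherical n m r \<theta> \<phi>"
  proof (cases "\<bar>m\<bar> > int n \<or> r = 0")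
    case True
    then show ?thesis
      by (cases "n = 0") (auto simp: harmonic_R_def harmonic_R_spherical_def norm_p assoc_legendre_0_0)
  next
    case False
    then have r: "r > 0" and m: "\<not> \<bar>m\<bar> > int n" using assms(1) by auto
    have theta: "arccos (p $ 3 / r) = \<theta>"
      using r assms by (simp add: p arccos_cos)
    show ?thesis
    proof (cases "m = 0 \<or> sin \<theta> \<noteq> 0")
      case True
      have "exp (\<i> * of_int m * of_real (Arg (Complex (p $ 1) (p $ 2)))) =
            exp (\<i> * of_int m * of_real \<phi>)"
      proof (cases "m = 0")
        case False
        with True have s: "sin \<theta> > 0"
          using assms sin_ge_zero[of \<theta>] by linarith
        have "Complex (p $ 1) (p $ 2) = of_real (r * sin \<theta>) * cis \<phi>"
          by (simp add: p complex_eq_iff)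
        then have "cis (Arg (Complex (p $ 1) (p $ 2))) = cis \<phi>"
          using r s by (subst cis_Arg) (auto simp: sgn_mult sgn_of_real sgn_div_norm norm_mult scaleR_conv_of_real field_simps)
        then have "cis (Arg (Complex (p $ 1) (p $ 2))) powi m = cis \<phi> powi m" by simp
        then show ?thesis
          unfolding cis_power_int by (simp add: cis_conv_exp mult.assoc)
      qed simp
      then show ?thesis
        unfolding harmonic_R_def harmonic_R_spherical_def norm_p theta by simp
    next
      case False
      then have "(cos \<theta>)\<^sup>2 = 1" using sin_cos_squared_add[of \<theta>] by simp
      with False have "assoc_legendre n (nat \<bar>m\<bar>) (cos \<theta>) = 0"
        by (intro assoc_legendre_pole) auto
      then show ?thesis
        unfolding harmonic_R_def harmonic_R_spherical_def norm_p theta by simp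
    qed
  qed
  then show ?thesis by (simp add: p_def)
qed

definition affine_param :: "real ^ 3 \<Rightarrow> real ^ 3 \<Rightarrow> real ^ 3 \<Rightarrow> real \<Rightarrow> real \<Rightarrow> real ^ 3" where
  "affine_param Ru Rv R0 u v = u *\<^sub>R Ru + v *\<^sub>R Rv + R0"

definition g_fun :: "real ^ 3 \<Rightarrow> real ^ 3 \<Rightarrow> real ^ 3 \<Rightarrow> nat \<Rightarrow> int \<Rightarrow> real \<Rightarrow> real \<Rightarrow> complex" where
  "g_fun Ru Rv R0 n m u v = harmonic_R n m (affine_param Ru Rv R0 u v)"

definition h_fun :: "real ^ 3 \<Rightarrow> real ^ 3 \<Rightarrow> real ^ 3 \<Rightarrow> nat \<Rightarrow> int \<Rightarrow> real \<Rightarrow> complex" where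
  "h_fun Ru Rv R0 n m u = g_fun Ru Rv R0 n m u (1 - u)"

definition i_int :: "real ^ 3 \<Rightarrow> real ^ 3 \<Rightarrow> real ^ 3 \<Rightarrow> nat \<Rightarrow> int \<Rightarrow> complex" where
  "i_int Ru Rv R0 n m =
     integral {0..1} (\<lambda>u. integral {0..1 - u} (\<lambda>v. g_fun Ru Rv R0 n m u v))"

definition j_int :: "real ^ 3 \<Rightarrow> real ^ 3 \<Rightarrow> real ^ 3 \<Rightarrow> nat \<Rightarrow> int \<Rightarrow> complex" where
  "j_int Ru Rv R0 n m = integral {0..1} (\<lambda>u. h_fun Ru Rv R0 n m u)"

end

theory Submission
  imports Defs
begin

text \<open>
  Up to the factor \<open>n!\<close>, \<open>R\<^sub>n\<^sup>m\<close> is the coefficient of \<open>t\<^sup>m\<close> in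
  \<open>(\<i> \<xi> t + \<i> \<eta> / t - z)\<^sup>n\<close>, where \<open>\<xi> = (x + \<i> y) / 2\<close> and
  \<open>\<eta> = (x - \<i> y) / 2\<close>; for the Legendre functions this is the Taylor expansion of
  \<open>(x\<^sup>2 - 1)\<^sup>n\<close>, since \<open>(\<mu> + t)\<^sup>2 - 1 = t (t + (\<mu>\<^sup>2 - 1) / t + 2 \<mu>)\<close>. Hence the partial
  derivatives of \<open>R\<^sub>n\<^sup>m\<close> in \<open>\<xi>\<close>, \<open>\<eta>\<close>, \<open>z\<close> are \<open>\<i> R\<close>, \<open>\<i> R\<close>, \<open>- R\<close> with lower
  index \<open>n - 1\<close> and upper index \<open>m - 1\<close>, \<open>m + 1\<close>, \<open>m\<close>, and Euler's identity for homogeneous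
  polynomials expresses \<open>n g\<close> through \<open>u g\<^sub>u + v g\<^sub>v\<close> and the derivative of \<open>R\<^sub>n\<^sup>m\<close> in direction
  \<open>R\<^sub>0\<close>. The divergence theorem for the field \<open>(u g, v g)\<close> on the triangle, whose flux passes
  only through the hypotenuse, gives the recurrence.
\<close>

section \<open>Trinomial coefficients\<close>

text \<open>The coefficient of \<open>t\<^sup>m\<close> in \<open>(a t + b / t + c)\<^sup>n\<close>.\<close>

fun trinom :: "'a::comm_ring_1 \<Rightarrow> 'a \<Rightarrow> 'a \<Rightarrow> nat \<Rightarrow> int \<Rightarrow> 'a" where
  "trinom a b c 0 m = (if m = 0 then 1 else 0)"
| "trinom a b c (Suc n) m =
     a * trinom a b c n (m - 1) + b * trinom a b c n (m + 1) + c * trinom a b c n m"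

lemma trinom_eq_0: "\<bar>m\<bar> > int n \<Longrightarrow> trinom a b c n m = 0"
  by (induction n arbitrary: m) auto

lemma trinom_lowest: "trinom a b c n (- int n) = b ^ n"
  by (induction n) (simp_all add: trinom_eq_0)

text \<open>Substituting \<open>1 / t\<close> for \<open>t\<close> exchanges the outer
  coefficients.\<close>

lemma trinom_uminus: "trinom a b c n (- m) = trinom b a c n m"
proof (induction n arbitrary: m)
  case (Suc n)
  have "- m - 1 = - (m + 1)" "- m + 1 = - (m - 1)" by simp_all
  then show ?case by (simp only: trinom.simps Suc) (simp add: algebra_simps)
qed simp

lemma of_real_trinom:
  "of_real (trinom a b c n m) = trinom (of_real a) (of_real b) (of_real c) n m"
  by (induction n arbitrary: m) auto

lemma trinom_scale: "trinom (r * a) (r * b) (r * c) n m = r ^ n * trinom a b c n m"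
  by (induction n arbitrary: m) (auto simp: algebra_simps)

text \<open>
  Substituting \<open>l t\<close> for \<open>t\<close>; the two cases avoid dividing by \<open>l\<close>, which vanishes on the \<open>z\<close>-axis.
\<close>

lemma trinom_shift:
  "trinom (l * a) b c n (int k) = l ^ k * trinom a (l * b) c n (int k) \<and>
   l ^ k * trinom (l * a) b c n (- int k) = trinom a (l * b) c n (- int k)"
proof (induction n arbitrary: k)
  case 0
  then show ?case by auto
next
  case (Suc n)
  show ?case
  proof (cases k)
    case 0
    have "trinom (l * a) b c n 1 = l * trinom a (l * b) c n 1"
         "l * trinom (l * a) b c n (- 1) = trinom a (l * b) c n (- 1)"
         "trinom (l * a) b c n 0 = trinom a (l * b) c n 0"
      using Suc[of 1] Suc[of 0] by simp_all
    then show ?thesis by (simp add: 0 algebra_simps)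
  next
    case (Suc j)
    have idx: "int k - 1 = int j" "int k + 1 = int (Suc k)"
      "- int k - 1 = - int (Suc k)" "- int k + 1 = - int j"
      using Suc by simp_all
    define L where "L = l ^ j"
    have L: "l ^ j = L" "l ^ k = l * L" "l ^ Suc k = l * (l * L)"
      by (simp_all add: Suc L_def)
    let ?T = "trinom (l * a) b c n" and ?T' = "trinom a (l * b) c n"
    note IH = Suc.IH[of j, unfolded L] Suc.IH[of k, unfolded L] Suc.IH[of "Suc k", unfolded L]
    have "l * a * ?T (int j) + b * ?T (int (Suc k)) + c * ?T (int k) =
          l * L * (a * ?T' (int j) + l * b * ?T' (int (Suc k)) + c * ?T' (int k))"
      using IH by (simp only: algebra_simps)
    moreover have "l * L * (l * a * ?T (- int (Suc k)) + b * ?T (- int j) + c * ?T (- int k)) =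
          a * (l * (l * L) * ?T (- int (Suc k))) + l * b * (L * ?T (- int j)) + c * (l * L * ?T (- int k))"
      by (simp only: algebra_simps)
    ultimately show ?thesis
      using IH unfolding trinom.simps idx L by simp
  qed
qed

text \<open>The derivative of a power with exponent \<open>n + 1\<close> is \<open>n + 1\<close>
  times the \<open>n\<close>-th power times the derivative of the base; the factors
  \<open>t\<close>, \<open>1 / t\<close> and \<open>1\<close> attached to \<open>a'\<close>,
  \<open>b'\<close> and \<open>c'\<close> shift the index.\<close>

lemma has_derivative_trinom:
  fixes a b c :: "'x::real_normed_vector \<Rightarrow> 'b::real_normed_field"
  assumes a: "(a has_derivative a') (at x)"
    and b: "(b has_derivative b') (at x)"
    and c: "(c has_derivative c') (at x)"
  shows "((\<lambda>p. trinom (a p) (b p) (c p) (Suc n) m) has_derivative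
           (\<lambda>h. of_nat (Suc n) * (a' h * trinom (a x) (b x) (c x) n (m - 1) +
                  b' h * trinom (a x) (b x) (c x) n (m + 1) +
                  c' h * trinom (a x) (b x) (c x) n m))) (at x)"
proof (induction n arbitrary: m)
  case 0
  show ?case
    by (auto intro!: derivative_eq_intros assms)
next
  case (Suc n)
  show ?case
    apply (subst trinom.simps(2))
    apply (rule has_derivative_eq_rhs)
     apply (rule has_derivative_add has_derivative_mult a b c Suc)+
    apply (rule ext)
    apply (simp add: algebra_simps)
    done
qed

section \<open>Legendre functions\<close>

text \<open>The trinomial is the coefficient of \<open>t^(n + m)\<close> in
  \<open>((x + t)^2 - 1)^n\<close>. That power depends on \<open>x + t\<close> only, so
  differentiating in \<open>x\<close> equals differentiating in \<open>t\<close>, which gives the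
  factor and raises the index.\<close>

lemma DERIV_trinom_legendre:
  fixes x :: real
  shows "((\<lambda>x. trinom 1 (x\<^sup>2 - 1) (2 * x) n m) has_real_derivative
           of_int (int n + m + 1) * trinom 1 (x\<^sup>2 - 1) (2 * x) n (m + 1)) (at x)"
proof (induction n arbitrary: m)
  case 0
  \<comment> \<open>At the only index with a nonzero trinomial, \<open>m = -1\<close>, the factor
    vanishes.\<close>
  have "real_of_int (m + 1) * (if m + 1 = 0 then 1 else 0) = 0" by simp
  then show ?case by (simp only: trinom.simps of_nat_0 add_0) (rule DERIV_const)
next
  case (Suc n)
  show ?case
    unfolding trinom.simps
    by (rule derivative_eq_intros Suc refl)+ (simp add: algebra_simps power2_eq_square)
qed

text \<open>For \<open>k = 0\<close> this is the lowest coefficient, of index \<open>- n\<close>;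
  the next derivative contributes the factor \<open>n + (k - n) + 1 = k + 1\<close>.\<close>

lemma higher_deriv_legendre:
  "(deriv ^^ k) (\<lambda>x::real. (x\<^sup>2 - 1) ^ n) =
     (\<lambda>x. fact k * trinom 1 (x\<^sup>2 - 1) (2 * x) n (int k - int n))"
proof (induction k)
  case 0
  then show ?case by (simp add: trinom_lowest)
next
  case (Suc k)
  have "deriv (\<lambda>x::real. fact k * trinom 1 (x\<^sup>2 - 1) (2 * x) n (int k - int n)) x =
        fact (Suc k) * trinom 1 (x\<^sup>2 - 1) (2 * x) n (int (Suc k) - int n)" for x
    using DERIV_cmult[OF DERIV_trinom_legendre[of n "int k - int n" x], of "fact k"]
    by (intro DERIV_imp_deriv) (simp add: algebra_simps)
  then show ?case by (simp add: Suc)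
qed

lemma assoc_legendre_trinom:
  "assoc_legendre n m \<mu> = (- sqrt (1 - \<mu>\<^sup>2)) ^ m * fact (n + m) / (2 ^ n * fact n) *
     trinom 1 (\<mu>\<^sup>2 - 1) (2 * \<mu>) n (int m)"
  by (simp add: assoc_legendre_def higher_deriv_legendre power_minus[of "sqrt _"] add.commute)

section \<open>Harmonic polynomials in Cartesian form\<close>

text \<open>After extracting \<open>- r / 2\<close>, \<open>trinom_shift\<close> moves the factor
  \<open>l\<close> from the first to the second coefficient. All dependence on \<open>e\<close> then
  sits in \<open>l ^ k\<close>, because \<open>l * b = - s^2\<close> is free of
  \<open>e\<close>.\<close>

lemma trinom_spherical:
  fixes r s \<mu> :: real and e :: complex
  assumes "e \<noteq> 0" "s\<^sup>2 = 1 - \<mu>\<^sup>2"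
  shows "trinom (\<i> * (of_real (r * s) * e / 2)) (\<i> * (of_real (r * s) / e / 2)) (- of_real (r * \<mu>)) n (int k) =
     (- of_real r / 2) ^ n * (- \<i> * of_real s * e) ^ k *
       of_real (trinom 1 (\<mu>\<^sup>2 - 1) (2 * \<mu>) n (int k))"
proof -
  define l where "l = - \<i> * of_real s * e"
  define q where "q = - complex_of_real r / 2"
  define b where "b = \<i> * of_real s / (- e)"
  have "trinom (\<i> * (of_real (r * s) * e / 2)) (\<i> * (of_real (r * s) / e / 2)) (- of_real (r * \<mu>)) n (int k)
      = trinom (q * (l * 1)) (q * b) (q * of_real (2 * \<mu>)) n (int k)"
    using assms by (simp add: l_def q_def b_def field_simps)
  also have "\<dots> = q ^ n * (l ^ k * trinom 1 (l * b) (of_real (2 * \<mu>)) n (int k))"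
    unfolding trinom_scale by (simp only: trinom_shift)
  also have "l * b = of_real (- (s\<^sup>2))"
    using assms(1) by (simp add: l_def b_def field_simps power2_eq_square)
  also have "- (s\<^sup>2) = \<mu>\<^sup>2 - 1" using assms(2) by simp
  finally show ?thesis by (simp add: of_real_trinom l_def q_def)
qed

text \<open>This replaces angles by coefficients that are real-linear in \<open>p\<close>, so that
  differentiation needs no case distinction on the axis.\<close>

lemma harmonic_R_trinom:
  "harmonic_R n m p =
     trinom (\<i> * Complex (p $ 1) (p $ 2) / 2) (\<i> * Complex (p $ 1) (- p $ 2) / 2) (- of_real (p $ 3)) n m / fact n"
proof (cases "\<bar>m\<bar> > int n")
  case True
  then show ?thesis by (simp add: harmonic_R_def harmonic_R_spherical_def trinom_eq_0)
next
  case False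
  define r where "r = norm p"
  define \<mu> where "\<mu> = p $ 3 / r"
  define s where "s = sqrt (1 - \<mu>\<^sup>2)"
  define \<phi> where "\<phi> = Arg (Complex (p $ 1) (p $ 2))"
  define e where "e = cis \<phi>"
  define k where "k = nat \<bar>m\<bar>"
  have r2: "r\<^sup>2 = (p $ 1)\<^sup>2 + (p $ 2)\<^sup>2 + (p $ 3)\<^sup>2"
    unfolding power2_norm_eq_inner r_def by (simp add: inner_vec_def sum_3 power2_eq_square)
  have r0: "r \<ge> 0" by (simp add: r_def)
  \<comment> \<open>At the origin this still holds: both sides are \<open>0\<close>.\<close>
  have p3: "p $ 3 = r * \<mu>" by (simp add: \<mu>_def r_def)
  have "\<bar>p $ 3\<bar> \<le> r" unfolding r_def by (rule component_le_norm_cart)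
  then have mu: "\<bar>\<mu>\<bar> \<le> 1" using r0 by (auto simp: \<mu>_def divide_simps)
  then have mu2: "\<mu>\<^sup>2 \<le> 1" by (simp add: abs_square_le_1)
  have s2: "s\<^sup>2 = 1 - \<mu>\<^sup>2" using mu2 by (simp add: s_def)
  have "cmod (Complex (p $ 1) (p $ 2)) = r * s"
  proof -
    have "(r * s)\<^sup>2 = (p $ 1)\<^sup>2 + (p $ 2)\<^sup>2"
      using r2 by (simp add: power_mult_distrib s2 p3 algebra_simps)
    then show ?thesis using r0 mu2
      by (simp add: cmod_def s_def real_sqrt_unique)
  qed
  then have xy: "Complex (p $ 1) (p $ 2) = of_real (r * s) * e"
    using rcis_cmod_Arg[of "Complex (p $ 1) (p $ 2)"] by (simp add: rcis_def e_def \<phi>_def)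
  have yx: "Complex (p $ 1) (- p $ 2) = of_real (r * s) / e"
  proof -
    have "Complex (p $ 1) (- p $ 2) = cnj (Complex (p $ 1) (p $ 2))" by (simp add: complex_eq_iff)
    also have "\<dots> = of_real (r * s) / e" unfolding xy by (simp add: e_def cis_cnj field_simps flip: cis_inverse)
    finally show ?thesis .
  qed
  have e0: "e \<noteq> 0" by (simp add: e_def)
  \<comment> \<open>Inverting \<open>e\<close> for negative \<open>m\<close> leaves the natural
    exponent \<open>k\<close>; it swaps the outer coefficients, in accordance with
    \<open>trinom_uminus\<close>.\<close>
  define e' where "e' = (if m \<ge> 0 then e else 1 / e)"
  have e'0: "e' \<noteq> 0" using e0 by (simp add: e'_def)
  have ek: "exp (\<i> * of_int m * of_real \<phi>) = e' ^ k"
  proof -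
    have "exp (\<i> * of_int m * of_real \<phi>) = e powi m"
      unfolding e_def cis_power_int by (simp add: cis_conv_exp mult.assoc)
    also have "\<dots> = e' ^ k"
      by (auto simp: power_int_def e'_def k_def field_simps)
    finally show ?thesis .
  qed
  have "trinom (\<i> * Complex (p $ 1) (p $ 2) / 2) (\<i> * Complex (p $ 1) (- p $ 2) / 2) (- of_real (p $ 3)) n m
      = trinom (\<i> * (of_real (r * s) * e' / 2)) (\<i> * (of_real (r * s) / e' / 2)) (- of_real (r * \<mu>)) n (int k)"
  proof (cases "m \<ge> 0")
    case True
    then show ?thesis by (simp add: xy yx p3 k_def e'_def)
  next
    case False
    then have "m = - int k" by (simp add: k_def)
    then show ?thesis using False by (simp add: xy yx p3 e'_def trinom_uminus)
  qed
  also have "\<dots> = (- of_real r / 2) ^ n * (- \<i> * of_real s * e') ^ k *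
       of_real (trinom 1 (\<mu>\<^sup>2 - 1) (2 * \<mu>) n (int k))"
    by (rule trinom_spherical[OF e'0 s2])
  also have "\<dots> = fact n * harmonic_R n m p"
  proof -
    have neg: "\<not> \<bar>m\<bar> > int n" and c: "cos (arccos \<mu>) = \<mu>"
      using False mu by (simp_all add: cos_arccos_abs)
    define W where "W = trinom 1 (\<mu>\<^sup>2 - 1) (2 * \<mu>) n (int k)"
    have "fact n * harmonic_R n m p = fact n * ((-1) ^ n * \<i> ^ k / fact (n + k) *
        of_real (r ^ n * ((- s) ^ k * fact (n + k) / (2 ^ n * fact n) * W)) * e' ^ k)"
      unfolding harmonic_R_def harmonic_R_spherical_def
      by (simp only: neg if_False ek assoc_legendre_trinom c W_def
            r_def[symmetric] \<mu>_def[symmetric] \<phi>_def[symmetric] k_def[symmetric] s_def[symmetric])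
    also have "\<dots> = ((-1) ^ n * of_real r ^ n / 2 ^ n) * (\<i> ^ k * (- of_real s) ^ k * e' ^ k) * of_real W"
      by simp
    also have "\<dots> = ((-1) * of_real r / 2) ^ n * (\<i> * (- of_real s) * e') ^ k * of_real W"
      by (simp only: power_mult_distrib power_divide)
    finally show ?thesis by (simp add: W_def)
  qed
  finally show ?thesis by simp
qed

section \<open>Integration over the triangle\<close>

lemma continuous_on_pair_compose:
  assumes "continuous_on UNIV (\<lambda>(u, v). f u v)" "continuous_on S a" "continuous_on S b"
  shows "continuous_on S (\<lambda>x. f (a x) (b x))"
  using continuous_on_compose2[OF assms(1) continuous_on_Pair[OF assms(2,3)]] by simp

lemma integral_rescale_unit:
  fixes f :: "real \<Rightarrow> 'a::banach"
  assumes "u \<le> 1"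
  shows "integral {0..1 - u} f = (1 - u) *\<^sub>R integral {0..1} (\<lambda>w. f ((1 - u) * w))"
proof (cases "u = 1")
  case False
  then have "(\<lambda>x. x / (1 - u)) ` {0..1 - u} = {0..1}"
    using assms by (auto simp: image_iff field_simps intro!: bexI[of _ "_ * (1 - u)"])
  then show ?thesis
    using integral_stretch_real[of "1 - u" 0 "1 - u" f] assms False by simp
qed simp

lemma continuous_on_integral_unit:
  fixes f :: "real \<Rightarrow> real \<Rightarrow> 'a::banach"
  assumes "continuous_on UNIV (\<lambda>(u, v). f u v)"
  shows "continuous_on S (\<lambda>u. integral {0..1} (f u))"
  using integral_continuous_on_param[of S 0 1 f] continuous_on_subset[OF assms] by simp

text \<open>Rescaling to a fixed interval moves the variable bound into the integrand.\<close>

lemma continuous_on_integral_triangle: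
  fixes f :: "real \<Rightarrow> real \<Rightarrow> 'a::banach"
  assumes "continuous_on UNIV (\<lambda>(u, v). f u v)"
  shows "continuous_on {0..1} (\<lambda>u. integral {0..1 - u} (f u))"
proof -
  have "continuous_on UNIV (\<lambda>(u, w). f u ((1 - u) * w))"
    unfolding split_beta
    by (rule continuous_on_pair_compose[OF assms]) (intro continuous_intros)+
  then have "continuous_on {0..1} (\<lambda>u. (1 - u) *\<^sub>R integral {0..1} (\<lambda>w. f u ((1 - u) * w)))"
    by (intro continuous_intros continuous_on_integral_unit)
  then show ?thesis
    by (rule continuous_on_eq) (simp add: integral_rescale_unit)
qed

text \<open>The left integrand is the divergence of \<open>(u g, v g)\<close>. This field is
  tangential on the legs \<open>u = 0\<close> and \<open>v = 0\<close>, and on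
  \<open>u + v = 1\<close> its flux density is \<open>(u + v) g = g\<close>.\<close>

lemma divergence_triangle:
  fixes g gu gv :: "real \<Rightarrow> real \<Rightarrow> 'a::banach"
  assumes D: "\<And>u v. ((\<lambda>(u, v). g u v) has_derivative (\<lambda>(h, k). h *\<^sub>R gu u v + k *\<^sub>R gv u v)) (at (u, v))"
    and cu: "continuous_on UNIV (\<lambda>(u, v). gu u v)"
    and cv: "continuous_on UNIV (\<lambda>(u, v). gv u v)"
  shows "integral {0..1} (\<lambda>u. integral {0..1 - u} (\<lambda>v. 2 *\<^sub>R g u v + u *\<^sub>R gu u v + v *\<^sub>R gv u v)) =
         integral {0..1} (\<lambda>u. g u (1 - u))"
proof -
  have cg: "continuous_on UNIV (\<lambda>(u, v). g u v)"
  proof -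
    have "isCont (\<lambda>(u, v). g u v) p" for p
      using has_derivative_continuous[OF D[of "fst p" "snd p"]] by simp
    then show ?thesis by (simp add: continuous_on_eq_continuous_at)
  qed
  note [continuous_intros] = continuous_on_pair_compose[OF cg] continuous_on_pair_compose[OF cu]
    continuous_on_pair_compose[OF cv]
  have path: "((\<lambda>t. g (a t) (b t)) has_vector_derivative a' *\<^sub>R gu (a t) (b t) + b' *\<^sub>R gv (a t) (b t)) (at t within S)"
    if "(a has_vector_derivative a') (at t within S)" "(b has_vector_derivative b') (at t within S)"
    for a b a' b' t S
    using has_derivative_compose[OF has_derivative_Pair[OF that[unfolded has_vector_derivative_def]] D]
    by (simp add: has_vector_derivative_def scaleR_add_right)
  txt \<open>
    In the coordinates \<open>v = (1 - u) w\<close> the triangle becomes the unit square. Integrating by parts in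
    \<open>w\<close> yields the values on the hypotenuse, and in \<open>u\<close> the boundary terms of \<open>u (1 - u) E u\<close> vanish.
  \<close>
  define E where "E u = integral {0..1} (\<lambda>w. g u ((1 - u) * w))" for u
  define E' where "E' u = integral {0..1} (\<lambda>w. gu u ((1 - u) * w) - w *\<^sub>R gv u ((1 - u) * w))" for u
  define V where "V u = integral {0..1} (\<lambda>w. w *\<^sub>R gv u ((1 - u) * w))" for u
  have EV: "E u + (1 - u) *\<^sub>R V u = g u (1 - u)" for u
  proof -
    have "((\<lambda>w. g u ((1 - u) * w) + w *\<^sub>R ((1 - u) *\<^sub>R gv u ((1 - u) * w))) has_integral
             (1 *\<^sub>R g u ((1 - u) * 1) - 0 *\<^sub>R g u ((1 - u) * 0))) {0..1}"
      by (rule fundamental_theorem_of_calculus)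
         (auto intro!: derivative_eq_intros path simp: algebra_simps)
    moreover have "((\<lambda>w. g u ((1 - u) * w) + (1 - u) *\<^sub>R (w *\<^sub>R gv u ((1 - u) * w))) has_integral
             (E u + (1 - u) *\<^sub>R V u)) {0..1}"
      unfolding E_def V_def
      by (intro has_integral_add has_integral_cmul integrable_integral integrable_continuous_real continuous_intros)
    ultimately show ?thesis
      by (auto simp: mult.commute dest: has_integral_unique)
  qed
  \<comment> \<open>For \<open>v = (1 - u) w\<close> one has
    \<open>u gu + v gv = u (gu - w gv) + w gv\<close>.\<close>
  have inner: "integral {0..1 - u} (\<lambda>v. 2 *\<^sub>R g u v + u *\<^sub>R gu u v + v *\<^sub>R gv u v) =
               (1 - u) *\<^sub>R (2 *\<^sub>R E u + u *\<^sub>R E' u + V u)" if "u \<le> 1" for u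
  proof -
    have "((\<lambda>w. 2 *\<^sub>R g u ((1 - u) * w) + u *\<^sub>R (gu u ((1 - u) * w) - w *\<^sub>R gv u ((1 - u) * w)) +
             w *\<^sub>R gv u ((1 - u) * w)) has_integral (2 *\<^sub>R E u + u *\<^sub>R E' u + V u)) {0..1}"
      unfolding E_def E'_def V_def
      by (intro has_integral_add has_integral_cmul integrable_integral integrable_continuous_real continuous_intros)
    then show ?thesis
      unfolding integral_rescale_unit[OF that]
      by (subst integral_unique) (auto simp: algebra_simps)
  qed
  \<comment> \<open>Differentiation under the integral; the inner argument
    \<open>(1 - u) * w\<close> contributes \<open>- w\<close>.\<close>
  have E': "(E has_vector_derivative E' u) (at u within {0..1})" if "u \<in> {0..1}" for u
  proof -
    have "((\<lambda>u. integral (cbox 0 1) (\<lambda>w. g u ((1 - u) * w))) has_vector_derivative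
        integral (cbox 0 1) (\<lambda>w. gu u ((1 - u) * w) - w *\<^sub>R gv u ((1 - u) * w))) (at u within {0..1})"
    proof (rule leibniz_rule_vector_derivative)
      show "((\<lambda>u. g u ((1 - u) * w)) has_vector_derivative
          gu u ((1 - u) * w) - w *\<^sub>R gv u ((1 - u) * w)) (at u within {0..1})" for u w
        by (rule has_vector_derivative_eq_rhs, rule path)
           (auto intro!: derivative_eq_intros)
      show "(\<lambda>w. g u ((1 - u) * w)) integrable_on cbox 0 1" for u
        unfolding cbox_interval by (intro integrable_continuous_real continuous_intros)
      show "continuous_on ({0..1} \<times> cbox 0 1)
              (\<lambda>(u, w). gu u ((1 - u) * w) - w *\<^sub>R gv u ((1 - u) * w))"
        unfolding split_beta by (intro continuous_intros)
    qed (use that in auto)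
    then show ?thesis by (simp add: E_def[abs_def] E'_def)
  qed
  have bdry: "((\<lambda>u. (1 - 2 * u) *\<^sub>R E u + (u * (1 - u)) *\<^sub>R E' u) has_integral
           (1 * (1 - 1)) *\<^sub>R E 1 - (0 * (1 - 0)) *\<^sub>R E 0) {0..1}"
    by (rule fundamental_theorem_of_calculus)
       (auto intro!: derivative_eq_intros E' simp: algebra_simps)
  have "((\<lambda>u. g u (1 - u)) has_integral integral {0..1} (\<lambda>u. g u (1 - u))) {0..1}"
    by (intro integrable_integral integrable_continuous_real continuous_intros)
  from has_integral_add[OF bdry this] have "((\<lambda>u. (1 - 2 * u) *\<^sub>R E u + (u * (1 - u)) *\<^sub>R E' u + g u (1 - u)) has_integral
      integral {0..1} (\<lambda>u. g u (1 - u))) {0..1}"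
    by simp
  then have "((\<lambda>u. integral {0..1 - u} (\<lambda>v. 2 *\<^sub>R g u v + u *\<^sub>R gu u v + v *\<^sub>R gv u v)) has_integral
      integral {0..1} (\<lambda>u. g u (1 - u))) {0..1}"
  proof (rule has_integral_eq[rotated])
    fix u :: real
    assume u: "u \<in> {0..1}"
    \<comment> \<open>By \<open>EV\<close> the hypotenuse term supplies one more \<open>E u\<close>,
      and \<open>(1 - 2 u) + 1 = 2 (1 - u)\<close> exposes the common factor.\<close>
    have "(1 - 2 * u) *\<^sub>R E u + (u * (1 - u)) *\<^sub>R E' u + g u (1 - u) =
          (1 - u) *\<^sub>R (2 *\<^sub>R E u + u *\<^sub>R E' u + V u)"
      unfolding EV[symmetric] by (simp add: algebra_simps flip: scaleR_2)
    then show "(1 - 2 * u) *\<^sub>R E u + (u * (1 - u)) *\<^sub>R E' u + g u (1 - u) =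
               integral {0..1 - u} (\<lambda>v. 2 *\<^sub>R g u v + u *\<^sub>R gu u v + v *\<^sub>R gv u v)"
      using u by (simp only: inner atLeastAtMost_iff)
  qed
  then show ?thesis by (rule integral_unique)
qed

section \<open>The recurrence\<close>

lemma affine_param_nth:
  "affine_param Ru Rv R0 u v $ i = u * (Ru $ i) + v * (Rv $ i) + R0 $ i"
  by (simp add: affine_param_def)

theorem lemma2:
  fixes Ru Rv R0 :: "real ^ 3" and n :: nat and m :: int
    and x0 y0 z0 :: real and \<xi>0 \<eta>0 :: complex
  assumes "n \<ge> 1" and "- int n \<le> m" and "m \<le> int n"
    and "x0 = R0 $ 1" and "y0 = R0 $ 2" and "z0 = R0 $ 3"
    and "\<xi>0 = (of_real x0 + \<i> * of_real y0) / 2"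
    and "\<eta>0 = (of_real x0 - \<i> * of_real y0) / 2"
  shows "i_int Ru Rv R0 n m =
    1 / (of_nat n + 2) *
      (\<i> * \<xi>0 * i_int Ru Rv R0 (n - 1) (m - 1)
       + \<i> * \<eta>0 * i_int Ru Rv R0 (n - 1) (m + 1)
       - of_real z0 * i_int Ru Rv R0 (n - 1) m
       + j_int Ru Rv R0 n m)"
proof -
  define A where "A = (\<lambda>p :: real ^ 3. \<i> * Complex (p $ 1) (p $ 2) / 2)"
  define B where "B = (\<lambda>p :: real ^ 3. \<i> * Complex (p $ 1) (- p $ 2) / 2)"
  define C where "C = (\<lambda>p :: real ^ 3. - complex_of_real (p $ 3))"
  define P where "P = affine_param Ru Rv R0"
  let ?g = "g_fun Ru Rv R0"
  have g: "?g n m u v = trinom (A (P u v)) (B (P u v)) (C (P u v)) n m / fact n" for n m u v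
    by (simp add: g_fun_def harmonic_R_trinom A_def B_def C_def P_def)
  have lin: "X (P u v) = u *\<^sub>R X Ru + v *\<^sub>R X Rv + X R0" if "X \<in> {A, B, C}" for X u v
    using that by (auto simp: A_def B_def C_def P_def affine_param_nth complex_eq_iff field_simps)
  have deriv: "((\<lambda>(u, v). X (P u v)) has_derivative (\<lambda>(h, k). h *\<^sub>R X Ru + k *\<^sub>R X Rv)) (at p)"
    if "X \<in> {A, B, C}" for X p
    unfolding lin[OF that] split_beta by (auto intro!: derivative_eq_intros)
  \<comment> \<open>The derivative of the harmonic polynomial of degree \<open>n + 1\<close> in
    direction \<open>R\<close>; the factor \<open>n + 1\<close> from
    \<open>has_derivative_trinom\<close> is absorbed by the factorials.\<close>
  define gd where "gd n m R u v = A R * ?g n (m - 1) u v + B R * ?g n (m + 1) u v + C R * ?g n m u v"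
    for n m R u v
  have Dg: "((\<lambda>(u, v). ?g (Suc n) m u v) has_derivative
      (\<lambda>(h, k). h *\<^sub>R gd n m Ru u v + k *\<^sub>R gd n m Rv u v)) (at (u, v))" for n m u v
  proof -
    let ?T = "trinom (A (P u v)) (B (P u v)) (C (P u v)) n"
    have fact_gd: "fact (Suc n) * gd n m R u v =
        of_nat (Suc n) * (A R * ?T (m - 1) + B R * ?T (m + 1) + C R * ?T m)" for R
      by (simp add: gd_def g flip: add_divide_distrib)
    have "((\<lambda>(u, v). trinom (A (P u v)) (B (P u v)) (C (P u v)) (Suc n) m) has_derivative
      (\<lambda>(h, k). h *\<^sub>R (fact (Suc n) * gd n m Ru u v) + k *\<^sub>R (fact (Suc n) * gd n m Rv u v))) (at (u, v))"
      using deriv[of A "(u, v)"] deriv[of B "(u, v)"] deriv[of C "(u, v)"]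
      unfolding split_beta fact_gd
      by (intro has_derivative_eq_rhs[OF has_derivative_trinom])
         (auto simp: algebra_simps scaleR_conv_of_real simp del: trinom.simps of_nat_Suc)
    then show ?thesis
      unfolding g split_beta
      by (intro has_derivative_eq_rhs[OF has_derivative_divide[OF _ has_derivative_const]])
         (auto simp: fun_eq_iff scaleR_conv_of_real add_divide_distrib simp del: trinom.simps fact_Suc)
  qed
  have cg: "continuous_on UNIV (\<lambda>(u, v). ?g n m u v)" for n m
  proof (cases n)
    case 0
    then show ?thesis by (simp add: g)
  next
    case (Suc k)
    have "isCont (\<lambda>(u, v). ?g (Suc k) m u v) p" for p
      using has_derivative_continuous[OF Dg[of k m "fst p" "snd p"]] by simp
    then show ?thesis by (simp add: Suc continuous_on_eq_continuous_at)
  qed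
  have cgd: "continuous_on UNIV (\<lambda>(u, v). gd n m R u v)" for n m R
    unfolding gd_def split_beta by (intro continuous_intros cg[unfolded split_beta])
  obtain k where n: "n = Suc k" using assms(1) by (cases n) auto
  \<comment> \<open>Euler's identity \<open>n g = gd k m (P u v) u v\<close> is the defining
    recursion of \<open>trinom\<close> divided by \<open>k!\<close>. Linearity of \<open>gd\<close>
    in the direction then splits \<open>P u v\<close> into \<open>u Ru\<close>, \<open>v Rv\<close>
    and \<open>R0\<close>.\<close>
  have euler: "2 *\<^sub>R ?g n m u v + u *\<^sub>R gd k m Ru u v + v *\<^sub>R gd k m Rv u v =
      (of_nat n + 2) * ?g n m u v - A R0 * ?g k (m - 1) u v - B R0 * ?g k (m + 1) u v
        - C R0 * ?g k m u v" for u v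
  proof -
    have "of_nat n * (x / fact n) = x / fact k" for x :: complex
      by (simp add: n del: of_nat_Suc)
    then have "of_nat n * ?g n m u v = gd k m (P u v) u v"
      by (simp add: gd_def g add_divide_distrib) (simp add: n add_divide_distrib)
    also have "\<dots> = u *\<^sub>R gd k m Ru u v + v *\<^sub>R gd k m Rv u v + gd k m R0 u v"
      unfolding gd_def by (simp add: lin algebra_simps)
    finally show ?thesis by (simp add: gd_def[of k m R0] algebra_simps scaleR_conv_of_real)
  qed
  let ?G = "\<lambda>n m u. integral {0..1 - u} (?g n m u)"
  have G: "(?g n m u has_integral ?G n m u) {0..1 - u}" for n m u
    by (intro integrable_integral integrable_continuous_real
          continuous_on_pair_compose[OF cg, of _ "\<lambda>_. u" "\<lambda>v. v", simplified] continuous_intros)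
  have I: "(?G n m has_integral i_int Ru Rv R0 n m) {0..1}" for n m
    unfolding i_int_def
    by (intro integrable_integral integrable_continuous_real continuous_on_integral_triangle cg)
  have "j_int Ru Rv R0 n m =
      integral {0..1} (\<lambda>u. integral {0..1 - u} (\<lambda>v. 2 *\<^sub>R ?g n m u v + u *\<^sub>R gd k m Ru u v + v *\<^sub>R gd k m Rv u v))"
    unfolding j_int_def h_fun_def n by (rule divergence_triangle[OF Dg cgd cgd, symmetric])
  also have "\<dots> = integral {0..1} (\<lambda>u. (of_nat n + 2) * ?G n m u - A R0 * ?G k (m - 1) u
      - B R0 * ?G k (m + 1) u - C R0 * ?G k m u)"
    unfolding euler
    by (intro integral_cong integral_unique has_integral_diff has_integral_mult_right G)
  also have "\<dots> = (of_nat n + 2) * i_int Ru Rv R0 n m - A R0 * i_int Ru Rv R0 k (m - 1)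
      - B R0 * i_int Ru Rv R0 k (m + 1) - C R0 * i_int Ru Rv R0 k m"
    by (intro integral_unique has_integral_diff has_integral_mult_right I)
  finally have J: "(of_nat n + 2) * i_int Ru Rv R0 n m = A R0 * i_int Ru Rv R0 k (m - 1)
      + B R0 * i_int Ru Rv R0 k (m + 1) + C R0 * i_int Ru Rv R0 k m + j_int Ru Rv R0 n m"
    by simp
  have coeffs: "A R0 = \<i> * \<xi>0" "B R0 = \<i> * \<eta>0" "C R0 = - of_real z0"
    using assms(4-8) by (simp_all add: A_def B_def C_def complex_eq_iff)
  have nz: "of_nat n + 2 \<noteq> (0 :: complex)"
    by (metis of_nat_add of_nat_numeral of_nat_eq_0_iff add_is_0 zero_neq_numeral)
  have "i_int Ru Rv R0 n m = 1 / (of_nat n + 2) * ((of_nat n + 2) * i_int Ru Rv R0 n m)"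
    using nz by simp
  then show ?thesis
    unfolding J coeffs by (simp add: n)
qed

end
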